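(* Let $(\Omega,d)$ be a separable metric space and let $\mu$ be a probability measure on the Borel $\sigma$-field of $(\Omega,d)$. Then $\mu$ satisfies a Gaussian concentration bound (i.e. $\mathrm{GCB}(D)$ for some $D>0$) if and only if it has a Gaussian moment (i.e. there exist $x_*\in\Omega$ and $a>0$ such that $\int e^{a\,d(x_*,x)^2}\,d\mu(x)<\infty$). More precisely: 1. If $\mu$ satisfies $\mathrm{GCB}(D)$, then for all $x_*\in\Omega$ $$\int e^{\frac{d(x_*,x)^2}{16D}}\,d\mu(x)\le 3\,\exp\left(\frac{\left(\int d(x,x_* )\,d\mu(x)\right)^2}{8D}\right).$$ 2. If there exist $x_*\in\Omega$, $a>0$ and $b\ge 1$ such that $$\int e^{a\,d(x_*,x)^2}\,d\mu(x)\le b,$$ then $\mu$ satisfies $\mathrm{GCB}(D)$ with $$D=\frac{b^2 e}{2a\sqrt{\pi}}.$$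
   Context: For $f:\Omega\to\mathbb{R}$, $\mathrm{lip}(f)=\sup_{x\ne y}|f(x)-f(y)|/d(x,y)$, and $\mathrm{Lip}(\Omega,\mathbb{R})$ is the set of real-valued Lipschitz functions on $(\Omega,d)$; $\mu(f)=\int f\,d\mu$. For $D>0$, $\mu$ satisfies $\mathrm{GCB}(D)$ on $(\Omega,d)$ if there exists $x_*\in\Omega$ such that $\int d(x_*,x)\,d\mu(x)<+\infty$ and for all $f\in\mathrm{Lip}(\Omega,\mathbb{R})$ $$\int e^{f-\mu(f)}\,d\mu\le e^{D\,\mathrm{lip}(f)^2}.$$ (The first-moment condition makes all Lipschitz functions $\mu$-integrable, and $\int d(y,x)\,d\mu(x)<\infty$ for all $y\in\Omega$.) Here $e$ is Euler's number. *)

theory Defs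
  imports "HOL-Probability.Probability"
begin

text \<open>The supremum is taken in the extended nonnegative reals, so that it is infinite for a
  non-Lipschitz function and \<open>0\<close> (empty supremum) on a one-point space.\<close>

definition lip :: "('a::metric_space \<Rightarrow> real) \<Rightarrow> ennreal" where
  "lip f = (SUP (x, y) \<in> {(x, y). x \<noteq> y}. ennreal (\<bar>f x - f y\<bar> / dist x y))"

definition Lip :: "('a::metric_space \<Rightarrow> real) set" where
  "Lip = {f. \<exists>C. C-lipschitz_on UNIV f}"

lemma lip_le_iff:
  assumes "0 \<le> C"
  shows "lip f \<le> ennreal C \<longleftrightarrow> C-lipschitz_on UNIV f"
proof
  assume L: "lip f \<le> ennreal C"
  show "C-lipschitz_on UNIV f"
  proof (rule lipschitz_onI)
    fix x y
    show "dist (f x) (f y) \<le> C * dist x y"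
    proof (cases "x = y")
      case False
      then have "ennreal (\<bar>f x - f y\<bar> / dist x y) \<le> lip f"
        unfolding lip_def by (intro SUP_upper2[of "(x, y)"]) auto
      then have "ennreal (\<bar>f x - f y\<bar> / dist x y) \<le> ennreal C"
        using L by (rule order_trans)
      then have "\<bar>f x - f y\<bar> / dist x y \<le> C"
        using assms by (simp add: ennreal_le_iff)
      then show ?thesis
        using False by (simp add: dist_real_def pos_divide_le_eq)
    qed simp
  qed fact
next
  assume L: "C-lipschitz_on UNIV f"
  have "\<bar>f x - f y\<bar> / dist x y \<le> C" if "x \<noteq> y" for x y
    using lipschitz_onD[OF L, of x y] that by (simp add: dist_real_def pos_divide_le_eq)
  then show "lip f \<le> ennreal C"
    unfolding lip_def by (intro SUP_least) (auto intro!: ennreal_leI)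
qed

lemma Lip_iff_lip_finite: "f \<in> Lip \<longleftrightarrow> lip f < \<infinity>"
proof
  assume "f \<in> Lip"
  then obtain C where C: "C-lipschitz_on UNIV f" by (auto simp: Lip_def)
  then have "lip f \<le> ennreal C"
    using lip_le_iff lipschitz_on_nonneg by blast
  then show "lip f < \<infinity>"
    by (simp add: order_le_less_trans)
next
  assume "lip f < \<infinity>"
  then have "lip f \<le> ennreal (enn2real (lip f))" by simp
  then show "f \<in> Lip"
    using lip_le_iff[of "enn2real (lip f)" f] by (auto simp: Lip_def)
qed

text \<open>The exponential moment is a nonnegative integral, so the bound includes its finiteness.
  The inner mean is a Bochner integral; it is a genuine one because the first-moment condition makes
  every Lipschitz function integrable.\<close>

definition GCB :: "'a::metric_space measure \<Rightarrow> real \<Rightarrow> bool" where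
  "GCB \<mu> D \<longleftrightarrow>
     (\<exists>x0. integrable \<mu> (\<lambda>x. dist x0 x)) \<and>
     (\<forall>f\<in>Lip. (\<integral>\<^sup>+ x. ennreal (exp (f x - (\<integral>y. f y \<partial>\<mu>))) \<partial>\<mu>)
                \<le> ennreal (exp (D * (enn2real (lip f))\<^sup>2)))"

definition gaussian_moment :: "'a::metric_space measure \<Rightarrow> bool" where
  "gaussian_moment \<mu> \<longleftrightarrow>
     (\<exists>x0. \<exists>a>0. (\<integral>\<^sup>+ x. ennreal (exp (a * (dist x0 x)\<^sup>2)) \<partial>\<mu>) < \<infinity>)"

end

theory Submission
  imports Defs
begin

text \<open>
  \<^emph>\<open>From concentration to a Gaussian moment.\<close> Averaging the Laplace transform of a random variable
  over a standard Gaussian parameter \<open>g\<close> turns it into a Gaussian moment, because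
  \<open>exp (t\<^sup>2 / 2)\<close> is the mean of \<open>exp (g t)\<close>.  If \<open>Y = d x0 - \<mu>(d x0)\<close> is the centred distance to
  \<open>x0\<close>, the concentration bound for the Lipschitz function \<open>g d x0 / (2 \<surd>D)\<close> gives
  \<open>\<mu>(exp (g Y / (2 \<surd>D))) \<le> exp (g\<^sup>2 / 4)\<close>.  Integrating in \<open>g\<close> and exchanging the integrals yields
  \<open>\<mu>(exp (Y\<^sup>2 / (8 D))) \<le> \<surd>2\<close>.  The first claim follows from
  \<open>(d x0)\<^sup>2 \<le> 2 Y\<^sup>2 + 2 (\<mu>(d x0))\<^sup>2\<close>, with the constant \<open>\<surd>2\<close> in place of \<open>3\<close>.

  \<^emph>\<open>From a Gaussian moment to concentration.\<close> Jensen's inequality replaces \<open>exp (- \<mu>(f))\<close> by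
  \<open>\<mu>(exp (- f))\<close>, so that it suffices to bound the double integral of \<open>exp (f x - f y)\<close>, which by
  symmetry is the double integral of \<open>cosh (f x - f y)\<close>.  If \<open>f\<close> is \<open>L\<close>-Lipschitz, then
  \<open>(f x - f y)\<^sup>2 \<le> s T\<close> with \<open>s = 2 L\<^sup>2 / a\<close> and \<open>T = a (dist x0 x)\<^sup>2 + a (dist x0 y)\<^sup>2\<close>, and the
  double integral of \<open>exp T\<close> is at most \<open>B = b\<^sup>2\<close>.  The whole matter is thus a one-dimensional
  inequality, \<open>cosh_le_affine_exp\<close>: whenever \<open>w\<^sup>2 \<le> s T\<close>, the number \<open>cosh w\<close> is at most an affine
  function of \<open>exp T\<close> whose value at \<open>B\<close> is at most \<open>exp (q s B)\<close>, where \<open>q = e / (4 \<surd>\<pi>)\<close>.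
  Integrating it gives the bound, since \<open>q s B = D L\<^sup>2\<close>.  All that is used about \<open>q\<close> is that
  \<open>q \<ge> 3/8\<close>.
\<close>

section \<open>Gaussian averages\<close>

lemma nn_integral_normal_density:
  assumes "\<sigma> > 0"
  shows "(\<integral>\<^sup>+ g. ennreal (normal_density m \<sigma> g) \<partial>lborel) = 1"
  using assms by (simp add: nn_integral_eq_integral)

lemma nn_integral_exp_normal_density:
  "(\<integral>\<^sup>+ g. ennreal (std_normal_density g * exp (t * g)) \<partial>lborel) = ennreal (exp (t\<^sup>2 / 2))"
proof -
  have "std_normal_density g * exp (t * g) = exp (t\<^sup>2 / 2) * normal_density t 1 g" for g
  proof -
    have "- g\<^sup>2 / 2 + t * g = t\<^sup>2 / 2 + - (g - t)\<^sup>2 / 2"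
      by (simp add: power2_eq_square field_simps)
    then have "exp (- g\<^sup>2 / 2) * exp (t * g) = exp (t\<^sup>2 / 2) * exp (- (g - t)\<^sup>2 / 2)"
      by (simp only: exp_add[symmetric])
    then show ?thesis by (simp add: normal_density_def)
  qed
  then have "(\<integral>\<^sup>+ g. ennreal (std_normal_density g * exp (t * g)) \<partial>lborel)
      = (\<integral>\<^sup>+ g. ennreal (exp (t\<^sup>2 / 2)) * ennreal (normal_density t 1 g) \<partial>lborel)"
    by (simp add: ennreal_mult)
  also have "\<dots> = ennreal (exp (t\<^sup>2 / 2))"
    by (subst nn_integral_cmult) (simp_all add: nn_integral_normal_density)
  finally show ?thesis .
qed

lemma nn_integral_exp_square_normal_density:
  "(\<integral>\<^sup>+ g. ennreal (std_normal_density g * exp (g\<^sup>2 / 4)) \<partial>lborel) = ennreal (sqrt 2)"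
proof -
  have "std_normal_density g * exp (g\<^sup>2 / 4) = sqrt 2 * normal_density 0 (sqrt 2) g" for g
  proof -
    have "exp (- g\<^sup>2 / 2) * exp (g\<^sup>2 / 4) = exp (- g\<^sup>2 / 4)"
      unfolding exp_add[symmetric] by (simp add: field_simps)
    moreover have "sqrt (2 * pi * (sqrt 2)\<^sup>2) = sqrt 2 * sqrt (2 * pi)"
      by (simp add: real_sqrt_mult)
    ultimately show ?thesis by (simp add: normal_density_def)
  qed
  then have "(\<integral>\<^sup>+ g. ennreal (std_normal_density g * exp (g\<^sup>2 / 4)) \<partial>lborel)
      = (\<integral>\<^sup>+ g. ennreal (sqrt 2) * ennreal (normal_density 0 (sqrt 2) g) \<partial>lborel)"
    by (simp add: ennreal_mult)
  also have "\<dots> = ennreal (sqrt 2)"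
    by (subst nn_integral_cmult) (simp_all add: nn_integral_normal_density)
  finally show ?thesis .
qed

text \<open>For fixed \<open>x\<close>, the integrand is the mean of \<open>exp (g Y x / (2 \<surd>D))\<close> over a standard Gaussian \<open>g\<close>.
  Once the integrals are exchanged, the Laplace bound applies for each fixed \<open>g\<close>.  The \<open>8\<close> leaves
  half of the Gaussian decay \<open>exp (- g\<^sup>2 / 2)\<close> unused, so that the integral in \<open>g\<close> converges.\<close>

lemma (in prob_space) nn_integral_exp_square_le:
  fixes Y :: "'a \<Rightarrow> real"
  assumes [measurable]: "Y \<in> borel_measurable M" and "D > 0"
    and laplace: "\<And>t. (\<integral>\<^sup>+ x. ennreal (exp (t * Y x)) \<partial>M) \<le> ennreal (exp (D * t\<^sup>2))"
  shows "(\<integral>\<^sup>+ x. ennreal (exp ((Y x)\<^sup>2 / (8 * D))) \<partial>M) \<le> ennreal (sqrt 2)"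
proof -
  interpret P: pair_sigma_finite lborel M ..
  define r where "r = 1 / (2 * sqrt D)"
  have r: "r\<^sup>2 = 1 / (4 * D)"
    using \<open>D > 0\<close> by (simp add: r_def power_divide power_mult_distrib)
  have "(\<integral>\<^sup>+ x. ennreal (exp ((Y x)\<^sup>2 / (8 * D))) \<partial>M)
      = (\<integral>\<^sup>+ x. \<integral>\<^sup>+ g. ennreal (std_normal_density g * exp (r * Y x * g)) \<partial>lborel \<partial>M)"
    by (simp add: nn_integral_exp_normal_density power_mult_distrib r)
  also have "\<dots> = (\<integral>\<^sup>+ g. \<integral>\<^sup>+ x. ennreal (std_normal_density g * exp (r * Y x * g)) \<partial>M \<partial>lborel)"
    by (rule P.Fubini') measurable
  also have "\<dots> = (\<integral>\<^sup>+ g. ennreal (std_normal_density g) *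
      (\<integral>\<^sup>+ x. ennreal (exp ((r * g) * Y x)) \<partial>M) \<partial>lborel)"
    by (subst nn_integral_cmult[symmetric]) (simp_all add: ennreal_mult mult_ac)
  also have "\<dots> \<le> (\<integral>\<^sup>+ g. ennreal (std_normal_density g) * ennreal (exp (D * (r * g)\<^sup>2)) \<partial>lborel)"
    by (intro nn_integral_mono mult_left_mono laplace) simp
  also have "\<dots> = (\<integral>\<^sup>+ g. ennreal (std_normal_density g * exp (g\<^sup>2 / 4)) \<partial>lborel)"
    using \<open>D > 0\<close> by (simp add: ennreal_mult power_mult_distrib r)
  finally show ?thesis by (simp only: nn_integral_exp_square_normal_density)
qed

section \<open>Gaussian moments from concentration\<close>

lemma enn2real_lip_le:
  assumes "C-lipschitz_on UNIV f"
  shows "enn2real (lip f) \<le> C"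
  using lip_le_iff[of C f] lipschitz_on_nonneg[OF assms] assms enn2real_leI by auto

lemma lipschitz_on_dist: "1-lipschitz_on UNIV (dist x0)"
proof (rule lipschitz_onI)
  fix x y :: 'a
  show "dist (dist x0 x) (dist x0 y) \<le> 1 * dist x y"
    using dist_triangle[of x0 x y] dist_triangle[of x0 y x]
    by (simp add: dist_real_def abs_le_iff dist_commute)
qed simp

lemma borel_measurable_dist_point [measurable]:
  "dist (x0 :: 'a::metric_space) \<in> borel_measurable borel"
  by (rule borel_measurable_continuous_onI) (rule lipschitz_on_continuous_on[OF lipschitz_on_dist])

lemma GCB_laplace_dist:
  assumes "GCB \<mu> D" "D > 0"
  shows "(\<integral>\<^sup>+ x. ennreal (exp (t * (dist x0 x - (\<integral>y. dist x0 y \<partial>\<mu>)))) \<partial>\<mu>)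
      \<le> ennreal (exp (D * t\<^sup>2))"
proof -
  have L: "\<bar>t\<bar>-lipschitz_on UNIV (\<lambda>x. t * dist x0 x)"
    using lipschitz_on_cmult_real[OF lipschitz_on_dist[of x0], of t] by simp
  then have "(\<lambda>x. t * dist x0 x) \<in> Lip" by (auto simp: Lip_def)
  then have "(\<integral>\<^sup>+ x. ennreal (exp (t * dist x0 x - (\<integral>y. t * dist x0 y \<partial>\<mu>))) \<partial>\<mu>)
      \<le> ennreal (exp (D * (enn2real (lip (\<lambda>x. t * dist x0 x)))\<^sup>2))"
    using assms(1) by (auto simp: GCB_def)
  also have "\<dots> \<le> ennreal (exp (D * t\<^sup>2))"
    using power_mono[OF enn2real_lip_le[OF L], of 2] assms(2) by (simp add: ennreal_leI)
  finally show ?thesis by (simp add: right_diff_distrib)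
qed

lemma GCB_imp_gaussian_moment_bound:
  fixes \<mu> :: "'a::metric_space measure"
  assumes "prob_space \<mu>" "sets \<mu> = sets borel" "GCB \<mu> D" "D > 0"
  shows "(\<integral>\<^sup>+ x. ennreal (exp ((dist x0 x)\<^sup>2 / (16 * D))) \<partial>\<mu>)
      \<le> ennreal (3 * exp ((\<integral>x. dist x x0 \<partial>\<mu>)\<^sup>2 / (8 * D)))"
proof -
  interpret prob_space \<mu> by fact
  note [measurable_cong] = assms(2)
  define m where "m = (\<integral>x. dist x0 x \<partial>\<mu>)"
  define Y where "Y x = dist x0 x - m" for x
  have [measurable]: "Y \<in> borel_measurable \<mu>" unfolding Y_def by measurable
  have "(\<integral>\<^sup>+ x. ennreal (exp ((dist x0 x)\<^sup>2 / (16 * D))) \<partial>\<mu>)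
      \<le> (\<integral>\<^sup>+ x. ennreal (exp (m\<^sup>2 / (8 * D))) * ennreal (exp ((Y x)\<^sup>2 / (8 * D))) \<partial>\<mu>)"
  proof (intro nn_integral_mono)
    fix x
    have "(dist x0 x)\<^sup>2 \<le> 2 * m\<^sup>2 + 2 * (Y x)\<^sup>2"
      using zero_le_power2[of "dist x0 x - 2 * m"]
      by (simp add: Y_def power2_eq_square algebra_simps)
    then have "(dist x0 x)\<^sup>2 / (16 * D) \<le> m\<^sup>2 / (8 * D) + (Y x)\<^sup>2 / (8 * D)"
      using assms(4) by (simp add: field_simps)
    then show "ennreal (exp ((dist x0 x)\<^sup>2 / (16 * D)))
        \<le> ennreal (exp (m\<^sup>2 / (8 * D))) * ennreal (exp ((Y x)\<^sup>2 / (8 * D)))"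
      by (simp add: ennreal_mult[symmetric] exp_add[symmetric] ennreal_leI)
  qed
  also have "\<dots> = ennreal (exp (m\<^sup>2 / (8 * D))) * (\<integral>\<^sup>+ x. ennreal (exp ((Y x)\<^sup>2 / (8 * D))) \<partial>\<mu>)"
    by (rule nn_integral_cmult) measurable
  also have "\<dots> \<le> ennreal (exp (m\<^sup>2 / (8 * D))) * ennreal (sqrt 2)"
    using GCB_laplace_dist[OF assms(3,4), of _ x0] assms(4)
    by (intro mult_left_mono nn_integral_exp_square_le) (simp_all add: Y_def m_def)
  also have "\<dots> \<le> ennreal (exp (m\<^sup>2 / (8 * D))) * ennreal 3"
    by (intro mult_left_mono ennreal_leI real_le_lsqrt) simp_all
  also have "\<dots> = ennreal (3 * exp (m\<^sup>2 / (8 * D)))"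
    by (simp add: ennreal_mult mult.commute)
  finally show ?thesis by (simp add: m_def dist_commute)
qed

section \<open>A pointwise bound on the hyperbolic cosine\<close>

text \<open>The quotient of the two sides decreases on the positive axis, its derivative having the sign
  of \<open>sinh w - w cosh w\<close>.\<close>

lemma cosh_le_exp_half_square: "cosh w \<le> exp (w\<^sup>2 / 2)" for w :: real
proof -
  have sinh_le: "sinh v \<le> v * cosh v" if "0 \<le> v" for v :: real
  proof -
    have "0 * cosh 0 - sinh 0 \<le> v * cosh v - sinh v"
      using that
    proof (rule DERIV_nonneg_imp_nondecreasing)
      fix u :: real assume "0 \<le> u" "u \<le> v"
      show "\<exists>y. ((\<lambda>u. u * cosh u - sinh u) has_real_derivative y) (at u) \<and> 0 \<le> y"
        by (rule exI[of _ "u * sinh u"]) (use \<open>0 \<le> u\<close> in \<open>auto intro!: derivative_eq_intros\<close>)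
    qed
    then show ?thesis by simp
  qed
  have pos: "cosh v \<le> exp (v\<^sup>2 / 2)" if "0 \<le> v" for v :: real
  proof -
    have "cosh v * exp (- v\<^sup>2 / 2) \<le> cosh 0 * exp (- 0\<^sup>2 / 2)"
      using that
    proof (rule DERIV_nonpos_imp_nonincreasing)
      fix u :: real assume "0 \<le> u" "u \<le> v"
      show "\<exists>y. ((\<lambda>u. cosh u * exp (- u\<^sup>2 / 2)) has_real_derivative y) (at u) \<and> y \<le> 0"
        by (rule exI[of _ "(sinh u - u * cosh u) * exp (- u\<^sup>2 / 2)"])
          (use sinh_le[OF \<open>0 \<le> u\<close>] in
            \<open>auto intro!: derivative_eq_intros mult_nonpos_nonneg simp: algebra_simps\<close>)
    qed
    then show ?thesis by (simp add: exp_minus field_simps)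
  qed
  show ?thesis
    using pos[of w] pos[of "- w"] by (cases "0 \<le> w") auto
qed

lemma cosh_le_exp_abs: "cosh w \<le> exp \<bar>w\<bar>" for w :: real
proof -
  have "exp w \<le> exp \<bar>w\<bar>" "exp (- w) \<le> exp \<bar>w\<bar>" by simp_all
  then have "exp w + exp (- w) \<le> 2 * exp \<bar>w\<bar>" by linarith
  then show ?thesis by (simp add: cosh_field_def)
qed

text \<open>The tangent to the logarithm at \<open>4/3\<close>, in the form needed at \<open>s = 2\<close>, where the two regimes of
  \<open>cosh_le_affine_exp\<close> meet.\<close>

lemma ln_add_half_le: "ln B + 1 / 2 \<le> 3 / 4 * B" if "B > 0" for B :: real
proof -
  have "ln (3 / 4 * B) \<le> 3 / 4 * B - 1"
    by (rule ln_le_minus_one) (use that in simp)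
  moreover have "ln (4 / 3) \<le> (4 / 3 - 1 :: real)"
    by (rule ln_le_minus_one) simp
  moreover have "ln (3 / 4 * B) = ln B - ln (4 / 3)"
    using that by (simp add: ln_mult ln_div)
  ultimately show ?thesis by simp
qed

text \<open>Let \<open>\<theta> = s / 2\<close>.  For \<open>\<theta> \<le> 1\<close>, the bound \<open>cosh w \<le> (exp T) powr \<theta>\<close> is concave in \<open>exp T\<close>, and
  the affine function is the tangent at \<open>exp T = B\<close>; it takes the value \<open>B powr \<theta>\<close> there.  For
  \<open>\<theta> \<ge> 1\<close> the quadratic bound on \<open>ln (cosh w)\<close> is too large, and
  \<open>\<bar>w\<bar> \<le> \<surd>(s T) \<le> T + s / 4\<close> gives a linear one.\<close>

lemma cosh_le_affine_exp:
  fixes B s q :: real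
  assumes "B \<ge> 1" "s \<ge> 0" "q \<ge> 3 / 8"
  obtains \<alpha> \<beta> where "\<alpha> \<ge> 0" "\<beta> \<ge> 0" "\<alpha> + \<beta> * B \<le> exp (q * s * B)"
    and "\<And>w T. w\<^sup>2 \<le> s * T \<Longrightarrow> cosh w \<le> \<alpha> + \<beta> * exp T"
proof (cases "s \<le> 2")
  case True
  define \<theta> where "\<theta> = s / 2"
  have \<theta>: "0 \<le> \<theta>" "\<theta> \<le> 1" using True assms by (auto simp: \<theta>_def)
  define l where "l = ln B"
  have B: "exp l = B" using assms by (simp add: l_def)
  show ?thesis
  proof (rule that[of "exp (\<theta> * l) * (1 - \<theta>)" "exp (\<theta> * l) * \<theta> / B"])
    have "l \<le> 2 * q * B"
      using ln_add_half_le[of B] mult_right_mono[OF assms(3), of B] assms(1)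
      unfolding l_def by linarith
    then have "\<theta> * l \<le> q * s * B"
      using mult_left_mono[of l "2 * q * B" \<theta>] \<theta> by (simp add: \<theta>_def mult_ac)
    moreover have "exp (\<theta> * l) * (1 - \<theta>) + exp (\<theta> * l) * \<theta> / B * B = exp (\<theta> * l)"
      using assms(1) by (simp add: algebra_simps)
    ultimately show "exp (\<theta> * l) * (1 - \<theta>) + exp (\<theta> * l) * \<theta> / B * B \<le> exp (q * s * B)"
      by simp
  next
    fix w T assume "w\<^sup>2 \<le> s * T"
    then have "cosh w \<le> exp (\<theta> * T)"
      by (intro order_trans[OF cosh_le_exp_half_square]) (simp add: \<theta>_def)
    also have "exp (\<theta> * T) = exp (\<theta> * l) * exp (\<theta> * (T - l))"
      by (simp add: exp_add[symmetric] algebra_simps)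
    also have "exp (\<theta> * (T - l)) \<le> (1 - \<theta>) + \<theta> * exp (T - l)"
      using convex_onD[OF exp_convex, of \<theta> 0 "T - l"] \<theta> by simp
    also have "exp (T - l) = exp T / B"
      by (simp add: exp_diff B)
    finally show "cosh w \<le> exp (\<theta> * l) * (1 - \<theta>) + exp (\<theta> * l) * \<theta> / B * exp T"
      by (simp add: algebra_simps)
  qed (use \<theta> assms in auto)
next
  case False
  show ?thesis
  proof (rule that[of 0 "exp (s / 4)"])
    have "ln B + s / 4 \<le> q * s * B"
    proof -
      have "3 / 8 * (s * B) \<le> q * (s * B)"
        by (rule mult_right_mono) (use assms in auto)
      moreover have "(s - 2) * 1 \<le> (s - 2) * B"
        by (rule mult_left_mono) (use assms False in auto)
      moreover have "ln B + 1 / 2 \<le> 3 / 4 * B"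
        by (rule ln_add_half_le) (use assms in simp)
      ultimately show ?thesis using False by (simp add: algebra_simps)
    qed
    then have "exp (ln B + s / 4) \<le> exp (q * s * B)" by simp
    then show "0 + exp (s / 4) * B \<le> exp (q * s * B)"
      using assms(1) by (simp add: exp_add mult.commute)
  next
    fix w T assume w: "w\<^sup>2 \<le> s * T"
    have "0 \<le> s * T" using w by (rule order_trans[OF zero_le_power2])
    then have "0 \<le> T" using False by (simp add: zero_le_mult_iff)
    have "\<bar>w\<bar>\<^sup>2 \<le> (T + s / 4)\<^sup>2"
      using w zero_le_power2[of "T - s / 4"] by (simp add: power2_eq_square algebra_simps)
    then have "\<bar>w\<bar> \<le> T + s / 4"
      by (rule power2_le_imp_le) (use \<open>0 \<le> T\<close> assms in simp)
    then have "exp \<bar>w\<bar> \<le> exp (s / 4) * exp T"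
      by (simp add: exp_add[symmetric] add.commute)
    then show "cosh w \<le> 0 + exp (s / 4) * exp T"
      using cosh_le_exp_abs[of w] by simp
  qed simp_all
qed

section \<open>Concentration from a Gaussian moment\<close>

lemma (in prob_space) exp_expectation_le:
  fixes g :: "'a \<Rightarrow> real"
  assumes g: "integrable M g"
  shows "ennreal (exp (expectation g)) \<le> (\<integral>\<^sup>+ x. ennreal (exp (g x)) \<partial>M)"
proof (cases "(\<integral>\<^sup>+ x. ennreal (exp (g x)) \<partial>M) < \<infinity>")
  case True
  have [measurable]: "g \<in> borel_measurable M" using g by simp
  have int: "integrable M (\<lambda>x. exp (g x))"
    using True by (intro integrableI_nonneg) simp_all
  have "exp (expectation g) \<le> expectation (\<lambda>x. exp (g x))"
    by (rule jensens_inequality[OF g, where I = UNIV]) (simp_all add: int exp_convex)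
  then show ?thesis
    by (subst nn_integral_eq_integral[OF int]) (simp_all add: ennreal_leI)
next
  case False
  then have "(\<integral>\<^sup>+ x. ennreal (exp (g x)) \<partial>M) = \<infinity>"
    by (metis infinity_ennreal_def less_top)
  then show ?thesis by simp
qed

text \<open>Jensen's inequality introduces an independent copy of the variable, and exchanging the two
  copies leaves only the even part of the exponential.\<close>

lemma (in prob_space) nn_integral_exp_centred_le_cosh:
  fixes f :: "'a \<Rightarrow> real"
  assumes f: "integrable M f"
  shows "(\<integral>\<^sup>+ x. ennreal (exp (f x - expectation f)) \<partial>M)
      \<le> (\<integral>\<^sup>+ x. \<integral>\<^sup>+ y. ennreal (cosh (f x - f y)) \<partial>M \<partial>M)"
proof -
  interpret P: pair_sigma_finite M M ..
  have [measurable]: "f \<in> borel_measurable M" using f by simp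
  let ?E = "\<lambda>x y. ennreal (exp (f x - f y))"
  let ?I = "\<integral>\<^sup>+ x. \<integral>\<^sup>+ y. ?E x y \<partial>M \<partial>M"
  have swap: "?I = (\<integral>\<^sup>+ x. \<integral>\<^sup>+ y. ?E y x \<partial>M \<partial>M)"
    by (rule P.Fubini'[of "\<lambda>x y. ?E y x"]) measurable
  have "(\<integral>\<^sup>+ x. ennreal (exp (f x - expectation f)) \<partial>M) \<le> ?I"
  proof (intro nn_integral_mono)
    fix x
    show "ennreal (exp (f x - expectation f)) \<le> (\<integral>\<^sup>+ y. ?E x y \<partial>M)"
      using exp_expectation_le[of "\<lambda>y. f x - f y"] f by (simp add: prob_space)
  qed
  also have "?I = (?I + ?I) / 2"
    by (simp add: mult_2[symmetric] mult.commute[of 2] ennreal_mult_divide_eq)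
  also have "?I + ?I = ?I + (\<integral>\<^sup>+ x. \<integral>\<^sup>+ y. ?E y x \<partial>M \<partial>M)"
    using swap by simp
  also have "\<dots> = (\<integral>\<^sup>+ x. \<integral>\<^sup>+ y. ?E x y + ?E y x \<partial>M \<partial>M)"
    by (simp add: nn_integral_add)
  also have "\<dots> / 2 = (\<integral>\<^sup>+ x. \<integral>\<^sup>+ y. (?E x y + ?E y x) / 2 \<partial>M \<partial>M)"
    by (simp add: nn_integral_divide)
  also have "\<dots> = (\<integral>\<^sup>+ x. \<integral>\<^sup>+ y. ennreal (cosh (f x - f y)) \<partial>M \<partial>M)"
    by (simp add: cosh_field_def divide_ennreal[symmetric] ennreal_plus[symmetric] del: ennreal_plus)
  finally show ?thesis .
qed

lemma integrable_dist_of_gaussian_moment: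
  fixes \<mu> :: "'a::metric_space measure"
  assumes "prob_space \<mu>" "sets \<mu> = sets borel" "a > 0"
    and "(\<integral>\<^sup>+ x. ennreal (exp (a * (dist x0 x)\<^sup>2)) \<partial>\<mu>) < \<infinity>"
  shows "integrable \<mu> (dist x0)"
proof (rule Bochner_Integration.integrable_bound)
  interpret prob_space \<mu> by fact
  note [measurable_cong] = assms(2)
  show "dist x0 \<in> borel_measurable \<mu>" by measurable
  have "integrable \<mu> (\<lambda>x. exp (a * (dist x0 x)\<^sup>2))"
    using assms(4) by (intro integrableI_nonneg) simp_all
  then show "integrable \<mu> (\<lambda>x. 1 / (4 * a) + exp (a * (dist x0 x)\<^sup>2))"
    by simp
  have "t \<le> 1 / (4 * a) + exp (a * t\<^sup>2)" for t :: real
  proof -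
    have "0 \<le> (2 * a * t - 1)\<^sup>2 / (4 * a)" using assms(3) by simp
    also have "\<dots> = 1 / (4 * a) + a * t\<^sup>2 - t"
      using assms(3) by (simp add: field_simps power2_eq_square)
    finally show ?thesis using exp_ge_add_one_self[of "a * t\<^sup>2"] by linarith
  qed
  then show "AE x in \<mu>. norm (dist x0 x) \<le> norm (1 / (4 * a) + exp (a * (dist x0 x)\<^sup>2))"
    using assms(3) by (simp add: add_nonneg_nonneg)
qed

lemma integrable_lipschitz:
  fixes M :: "'a::metric_space measure" and f :: "'a \<Rightarrow> real"
  assumes "finite_measure M" "sets M = sets borel" "integrable M (dist x0)" "C-lipschitz_on UNIV f"
  shows "integrable M f"
proof (rule Bochner_Integration.integrable_bound)
  interpret finite_measure M by fact
  note [measurable_cong] = assms(2)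
  have [measurable]: "f \<in> borel_measurable borel"
    using lipschitz_on_continuous_on[OF assms(4)] by (rule borel_measurable_continuous_onI)
  show "f \<in> borel_measurable M" by measurable
  show "integrable M (\<lambda>x. \<bar>f x0\<bar> + C * dist x0 x)"
    using assms(3) by simp
  have "\<bar>f x\<bar> \<le> \<bar>f x0\<bar> + C * dist x0 x" for x
    using lipschitz_onD[OF assms(4), of x0 x] by (simp add: dist_real_def)
  then show "AE x in M. norm (f x) \<le> norm (\<bar>f x0\<bar> + C * dist x0 x)"
    by (auto intro!: AE_I2 intro: order_trans[OF _ abs_ge_self])
qed

lemma exp_one_div_sqrt_pi_ge: "exp 1 / (4 * sqrt pi) \<ge> 3 / 8"
proof -
  have "3 / 2 * sqrt pi \<le> exp 1"
  proof (rule power2_le_imp_le)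
    have "(3 / 2 * sqrt pi)\<^sup>2 = 9 / 4 * pi"
      by (simp add: power_mult_distrib power_divide)
    also have "\<dots> \<le> (27 / 10)\<^sup>2"
      using pi_approx(2) by (simp add: power2_eq_square)
    also have "\<dots> \<le> (exp 1)\<^sup>2"
      using e_approx_32 by (intro power_mono) (simp_all only: abs_le_iff, simp_all)
    finally show "(3 / 2 * sqrt pi)\<^sup>2 \<le> (exp 1)\<^sup>2" .
  qed simp
  then show ?thesis by (simp add: field_simps)
qed

lemma gaussian_moment_bound_imp_GCB:
  fixes \<mu> :: "'a::metric_space measure"
  assumes "prob_space \<mu>" "sets \<mu> = sets borel" "a > 0" "b \<ge> 1"
    and moment: "(\<integral>\<^sup>+ x. ennreal (exp (a * (dist x0 x)\<^sup>2)) \<partial>\<mu>) \<le> ennreal b"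
  shows "GCB \<mu> (b\<^sup>2 * exp 1 / (2 * a * sqrt pi))"
  unfolding GCB_def
proof (intro conjI ballI)
  interpret prob_space \<mu> by fact
  note [measurable_cong] = assms(2)
  have "(\<integral>\<^sup>+ x. ennreal (exp (a * (dist x0 x)\<^sup>2)) \<partial>\<mu>) < \<infinity>"
    using moment by (rule order_le_less_trans) simp
  then have int: "integrable \<mu> (dist x0)"
    by (rule integrable_dist_of_gaussian_moment[OF assms(1-3)])
  then show "\<exists>x0. integrable \<mu> (\<lambda>x. dist x0 x)" by blast
  fix f :: "'a \<Rightarrow> real" assume "f \<in> Lip"
  define L where "L = enn2real (lip f)"
  have "L \<ge> 0" by (simp add: L_def)
  have "L-lipschitz_on UNIV f"
    using \<open>f \<in> Lip\<close> lip_le_iff[OF \<open>L \<ge> 0\<close>, of f] by (simp add: Lip_iff_lip_finite L_def)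
  then have f: "integrable \<mu> f" and lip: "\<bar>f x - f y\<bar> \<le> L * dist x y" for x y
    using integrable_lipschitz[OF finite_measure_axioms assms(2) int] lipschitz_onD[of L UNIV f x y]
    by (auto simp: dist_real_def)
  have [measurable]: "f \<in> borel_measurable \<mu>" using f by simp
  define s where "s = 2 * L\<^sup>2 / a"
  define q where "q = exp 1 / (4 * sqrt pi)"
  define G where "G x = exp (a * (dist x0 x)\<^sup>2)" for x
  have [measurable]: "G \<in> borel_measurable \<mu>" unfolding G_def by measurable
  have "1 \<le> b\<^sup>2" using assms(4) by (simp add: one_le_power)
  moreover have "s \<ge> 0" using assms(3) by (simp add: s_def)
  ultimately obtain \<alpha> \<beta> where ab: "\<alpha> \<ge> 0" "\<beta> \<ge> 0" "\<alpha> + \<beta> * b\<^sup>2 \<le> exp (q * s * b\<^sup>2)"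
    and cosh: "\<And>w T. w\<^sup>2 \<le> s * T \<Longrightarrow> cosh w \<le> \<alpha> + \<beta> * exp T"
    using cosh_le_affine_exp[of "b\<^sup>2" s q] exp_one_div_sqrt_pi_ge unfolding q_def by metis
  have pointwise: "cosh (f x - f y) \<le> \<alpha> + \<beta> * (G x * G y)" for x y
  proof -
    have "\<bar>f x - f y\<bar> \<le> L * (dist x0 x + dist x0 y)"
      using lip[of x y] mult_left_mono[OF dist_triangle3[of x y x0] \<open>L \<ge> 0\<close>] by simp
    then have "\<bar>f x - f y\<bar>\<^sup>2 \<le> (L * (dist x0 x + dist x0 y))\<^sup>2"
      by (rule power_mono) simp
    also have "\<dots> \<le> L\<^sup>2 * (2 * ((dist x0 x)\<^sup>2 + (dist x0 y)\<^sup>2))"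
      unfolding power_mult_distrib
      using zero_le_power2[of "dist x0 x - dist x0 y"]
      by (intro mult_left_mono) (simp_all add: power2_eq_square algebra_simps)
    also have "\<dots> = s * (a * (dist x0 x)\<^sup>2 + a * (dist x0 y)\<^sup>2)"
      using assms(3) by (simp add: s_def field_simps)
    finally show ?thesis
      using cosh[of "f x - f y" "a * (dist x0 x)\<^sup>2 + a * (dist x0 y)\<^sup>2"]
      by (simp add: G_def exp_add)
  qed
  let ?m = "\<integral>\<^sup>+ x. ennreal (G x) \<partial>\<mu>"
  have "(\<integral>\<^sup>+ x. ennreal (exp (f x - (\<integral>y. f y \<partial>\<mu>))) \<partial>\<mu>)
      \<le> (\<integral>\<^sup>+ x. \<integral>\<^sup>+ y. ennreal (cosh (f x - f y)) \<partial>\<mu> \<partial>\<mu>)"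
    by (rule nn_integral_exp_centred_le_cosh[OF f])
  also have "\<dots> \<le> (\<integral>\<^sup>+ x. \<integral>\<^sup>+ y. ennreal \<alpha> + ennreal \<beta> * (ennreal (G x) * ennreal (G y)) \<partial>\<mu> \<partial>\<mu>)"
    using pointwise ab
    by (intro nn_integral_mono)
      (simp add: G_def ennreal_mult[symmetric] ennreal_plus[symmetric] ennreal_leI del: ennreal_plus)
  also have "\<dots> = ennreal \<alpha> + ennreal \<beta> * (?m * ?m)"
    by (simp add: nn_integral_add nn_integral_cmult nn_integral_multc emeasure_space_1)
  also have "\<dots> \<le> ennreal \<alpha> + ennreal \<beta> * (ennreal b * ennreal b)"
    using moment unfolding G_def by (intro add_left_mono mult_left_mono mult_mono) simp_all
  also have "\<dots> = ennreal (\<alpha> + \<beta> * b\<^sup>2)"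
    using ab assms(4) by (simp add: ennreal_mult power2_eq_square)
  also have "\<dots> \<le> ennreal (exp (q * s * b\<^sup>2))"
    using ab by (intro ennreal_leI)
  also have "q * s * b\<^sup>2 = b\<^sup>2 * exp 1 / (2 * a * sqrt pi) * L\<^sup>2"
    by (simp add: q_def s_def mult_ac)
  finally show "(\<integral>\<^sup>+ x. ennreal (exp (f x - (\<integral>y. f y \<partial>\<mu>))) \<partial>\<mu>)
      \<le> ennreal (exp (b\<^sup>2 * exp 1 / (2 * a * sqrt pi) * (enn2real (lip f))\<^sup>2))"
    by (simp only: L_def)
qed

section \<open>Equivalence of the two properties\<close>

theorem theorem2p1:
  fixes \<mu> :: "'a::metric_space measure"
  assumes "separable_space (euclidean :: 'a topology)"
    and "prob_space \<mu>"
    and "sets \<mu> = sets borel"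
  shows "((\<exists>D>0. GCB \<mu> D) \<longleftrightarrow> gaussian_moment \<mu>) \<and>
    (\<forall>D>0. GCB \<mu> D \<longrightarrow>
       (\<forall>x0. (\<integral>\<^sup>+ x. ennreal (exp ((dist x0 x)\<^sup>2 / (16 * D))) \<partial>\<mu>)
          \<le> ennreal (3 * exp ((\<integral>x. dist x x0 \<partial>\<mu>)\<^sup>2 / (8 * D))))) \<and>
    (\<forall>x0 a b. a > 0 \<longrightarrow> b \<ge> 1 \<longrightarrow>
       (\<integral>\<^sup>+ x. ennreal (exp (a * (dist x0 x)\<^sup>2)) \<partial>\<mu>) \<le> ennreal b \<longrightarrow>
       GCB \<mu> (b\<^sup>2 * exp 1 / (2 * a * sqrt pi)))"
proof (intro conjI allI impI iffI)
  assume "\<exists>D>0. GCB \<mu> D"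
  then obtain D where D: "D > 0" "GCB \<mu> D" by blast
  fix x0 :: 'a
  have "(\<integral>\<^sup>+ x. ennreal (exp (1 / (16 * D) * (dist x0 x)\<^sup>2)) \<partial>\<mu>) < \<infinity>"
    using GCB_imp_gaussian_moment_bound[OF assms(2,3) D(2,1), of x0]
    by (simp add: order_le_less_trans[OF _ ennreal_less_top])
  then show "gaussian_moment \<mu>"
    unfolding gaussian_moment_def using D(1) by (intro exI[of _ x0] exI[of _ "1 / (16 * D)"]) simp
next
  assume "gaussian_moment \<mu>"
  then obtain x0 a where a: "a > 0" and fin: "(\<integral>\<^sup>+ x. ennreal (exp (a * (dist x0 x)\<^sup>2)) \<partial>\<mu>) < \<infinity>"
    by (auto simp: gaussian_moment_def)
  define b where "b = max 1 (enn2real (\<integral>\<^sup>+ x. ennreal (exp (a * (dist x0 x)\<^sup>2)) \<partial>\<mu>))"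
  have "(\<integral>\<^sup>+ x. ennreal (exp (a * (dist x0 x)\<^sup>2)) \<partial>\<mu>)
      = ennreal (enn2real (\<integral>\<^sup>+ x. ennreal (exp (a * (dist x0 x)\<^sup>2)) \<partial>\<mu>))"
    using fin by simp
  also have "\<dots> \<le> ennreal b" by (intro ennreal_leI) (simp add: b_def)
  finally have "GCB \<mu> (b\<^sup>2 * exp 1 / (2 * a * sqrt pi))"
    using gaussian_moment_bound_imp_GCB[OF assms(2,3) a, of b x0] by (simp add: b_def)
  moreover have "b > 0" by (simp add: b_def)
  then have "b\<^sup>2 * exp 1 / (2 * a * sqrt pi) > 0" using a by simp
  ultimately show "\<exists>D>0. GCB \<mu> D" by blast
qed (use assms GCB_imp_gaussian_moment_bound gaussian_moment_bound_imp_GCB in blast)+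

end
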